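(* Let $\hat{\mathcal P}$ be an affine flag manifold for $G$ (a conjugacy class of proper parahoric subalgebras of $\mathfrak g_F$), and suppose that $N\in\mathfrak g_F$ almost commutes with the $Q_G$-action $f$. Then $f$ induces an action on $\hat{\mathcal P}_N$, the subvariety of $\hat{\mathcal P}$ of parahoric subalgebras containing $N$; that is, the $k^*$-action $f$ on $\hat{\mathcal P}$ preserves $\hat{\mathcal P}_N$.
   Context: $k$ is an algebraically closed field, $G$ a semisimple, simply connected algebraic group over $k$ with Lie algebra $\mathfrak g$, $F=k((\pi))$, $A=k[[\pi]]$, $\mathfrak g_F=\mathfrak g\otimes_k F$, $\mathfrak g_A=\mathfrak g\otimes_k A$. An Iwahori subalgebra of $\mathfrak g_F$ is a $G(F)$-conjugate of the preimage of a Borel subalgebra under the projection $\mathfrak g_A\to\mathfrak g$ ($\pi\mapsto0$); a parahoric subalgebra is a subalgebra containing an Iwahori subalgebra. An affine flag manifold $\hat{\mathcal P}$ is the set of all $G(F)$-conjugates of a fixed proper parahoric subalgebra $\hat{\mathfrak p}$, identified with $G(F)/\hat P$ where $\hat P$ is the stabilizer of $\hat{\mathfrak p}$ under the adjoint action. The group $k^*$ acts on $F$ by $k$-algebra automorphisms with $\lambda\cdot\pi^m=\lambda^m\pi^m$; this induces actions on $G(F)$, $G_{\mathrm{ad}}(F)$ and $\mathfrak g_F$, written $h\mapsto h^\lambda$, $N\mapsto N^\lambda$ ($G_{\mathrm{ad}}$ is the adjoint form of $G$). Let $Q_G=G_{\mathrm{ad}}(F)\rtimes k^*$. It acts on $\mathfrak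 g_F$ by $(g,\lambda)\cdot N=\mathrm{Ad}(g)N^\lambda$, and hence on each affine flag manifold by $(g,\lambda)\cdot\hat{\mathfrak p}=\mathrm{Ad}(g)\hat{\mathfrak p}^\lambda$ (equivalently $(g,\lambda)\cdot h\hat P=gh^\lambda\hat P$ for the standard parahoric subgroups $\hat P$). A $Q_G$-action is a $k^*$-action obtained from an algebraic homomorphism $f:k^*\to Q_G$; its second component is $\lambda\mapsto\lambda^p$ for some integer $p$. $f$ almost commutes with $N\in\mathfrak g_F$ if for some nonzero integer $s$ (the exponent), $f(\lambda)\cdot N=\lambda^sN$ for all $\lambda\in k^*$.
   Formalization: That f maps the affine flag manifold to itself is assumed, not proved; as literally defined it can fail (SL_2, characteristic 2). Without it, only f(t)P_N = the members of f(t)P containing N is shown. *)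

theory Defs
  imports
    "HOL-Analysis.Abstract_Topology"
    "HOL-Library.Poly_Mapping"
    "HOL-Computational_Algebra.Computational_Algebra"
    "HOL-Algebra.Group_Action"
    "HOL-Algebra.Solvable_Groups"
    "Jordan_Normal_Form.Determinant"
begin

section \<open>Affine algebraic groups as closed subgroups of general linear groups\<close>

text \<open>Varieties are identified with their sets of points over the algebraically closed field
  \<open>'k\<close>; an affine algebraic group is a Zariski closed subgroup of some \<open>GL n\<close>.\<close>

abbreviation GL :: "nat \<Rightarrow> ('a::comm_ring_1) mat monoid" where
  "GL n \<equiv> units_of (ring_mat TYPE('a) n ())"

text \<open>A polynomial in the matrix entries is a finitely supported map from monomials to
  coefficients; a monomial is a finitely supported map from index pairs to exponents.\<close>

type_synonym 'k mpol = "(nat \<times> nat \<Rightarrow>\<^sub>0 nat) \<Rightarrow>\<^sub>0 'k"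

definition pols :: "nat \<Rightarrow> 'k::zero mpol set" where
  "pols n = {p. \<forall>u \<in> Poly_Mapping.keys p. Poly_Mapping.keys u \<subseteq> {..<n} \<times> {..<n}}"

text \<open>The value of \<open>p\<close> at a matrix over the \<open>'k\<close>-algebra \<open>'a\<close> with structure map \<open>h\<close>.\<close>

definition peval :: "('k::zero \<Rightarrow> 'a::comm_ring_1) \<Rightarrow> 'k mpol \<Rightarrow> 'a mat \<Rightarrow> 'a" where
  "peval h p X = (\<Sum>u \<in> Poly_Mapping.keys p. h (Poly_Mapping.lookup p u) *
     (\<Prod>v \<in> Poly_Mapping.keys u. (X $$ v) ^ Poly_Mapping.lookup u v))"

definition zariski :: "nat \<Rightarrow> 'k::field mat topology" where
  "zariski n = topology_generated_by {{x \<in> carrier (GL n). peval id p x \<noteq> 0} | p. p \<in> pols n}"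

definition alg_group :: "nat \<Rightarrow> 'k::field mat set \<Rightarrow> bool" where
  "alg_group n G \<longleftrightarrow> subgroup G (GL n) \<and> closedin (zariski n) G"

definition connected_alg_group :: "nat \<Rightarrow> 'k::field mat set \<Rightarrow> bool" where
  "connected_alg_group n G \<longleftrightarrow> alg_group n G \<and> connectedin (zariski n) G"

definition vanishing_ideal :: "nat \<Rightarrow> 'k::field mat set \<Rightarrow> 'k mpol set" where
  "vanishing_ideal n G = {p \<in> pols n. \<forall>x \<in> G. peval id p x = 0}"

text \<open>Semisimple: connected with trivial radical.\<close>

definition semisimple :: "nat \<Rightarrow> 'k::field mat set \<Rightarrow> bool" where
  "semisimple n G \<longleftrightarrow> connected_alg_group n G \<and>
     (\<forall>R. connected_alg_group n R \<and> R \<lhd> (GL n)\<lparr>carrier := G\<rparr> \<and>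
          solvable ((GL n)\<lparr>carrier := R\<rparr>) \<longrightarrow> R = {1\<^sub>m n})"

text \<open>Regular maps from a closed subset \<open>X\<close> of \<open>GL m\<close> to \<open>n \<times> n\<close> matrices: the coordinate
  ring of \<open>GL m\<close> is generated by the entries and the inverse of the determinant, and it
  surjects onto that of \<open>X\<close>.\<close>

definition regular_map :: "nat \<Rightarrow> nat \<Rightarrow> 'k::field mat set \<Rightarrow> ('k mat \<Rightarrow> 'k mat) \<Rightarrow> bool" where
  "regular_map m n X \<phi> \<longleftrightarrow> \<phi> ` X \<subseteq> carrier_mat n n \<and>
     (\<forall>i<n. \<forall>j<n. \<exists>p \<in> pols m. \<exists>e::nat. \<forall>x \<in> X. \<phi> x $$ (i, j) = peval id p x / det x ^ e)"

text \<open>Central isogenies in the sense of Borel and Tits: the commutator map of the source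
  factors through a morphism \<open>\<kappa>\<close> on the square of the target. For an isogeny this says that
  the scheme-theoretic kernel is central, which in positive characteristic is stronger than
  centrality of the group of rational points of the kernel. The product of \<open>G\<close> with itself
  is embedded block-diagonally in \<open>GL (n + n)\<close>.\<close>

definition block_diag :: "nat \<Rightarrow> 'k::field mat \<Rightarrow> 'k mat \<Rightarrow> 'k mat" where
  "block_diag n x y = four_block_mat x (0\<^sub>m n n) (0\<^sub>m n n) y"

definition central_isogeny ::
    "nat \<Rightarrow> 'k::field mat set \<Rightarrow> nat \<Rightarrow> 'k mat set \<Rightarrow> ('k mat \<Rightarrow> 'k mat) \<Rightarrow> bool" where
  "central_isogeny m H n G \<phi> \<longleftrightarrow>
     \<phi> \<in> hom ((GL m)\<lparr>carrier := H\<rparr>) ((GL n)\<lparr>carrier := G\<rparr>) \<and> regular_map m n H \<phi> \<and>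
     \<phi> ` H = G \<and> finite {x \<in> H. \<phi> x = 1\<^sub>m n} \<and>
     (\<exists>\<kappa>. regular_map (n + n) m {block_diag n x y | x y. x \<in> G \<and> y \<in> G} \<kappa> \<and>
        (\<forall>x \<in> H. \<forall>y \<in> H.
           \<kappa> (block_diag n (\<phi> x) (\<phi> y)) = x * y * inv\<^bsub>GL m\<^esub> x * inv\<^bsub>GL m\<^esub> y))"

text \<open>Simply connected: every central isogeny from a connected group is an isomorphism, that is,
  has a regular inverse.\<close>

definition simply_connected :: "nat \<Rightarrow> 'k::field mat set \<Rightarrow> bool" where
  "simply_connected n G \<longleftrightarrow>
     (\<forall>m H \<phi>. connected_alg_group m H \<and> central_isogeny m H n G \<phi> \<longrightarrow>
        (\<exists>\<psi>. regular_map n m G \<psi> \<and> (\<forall>x \<in> H. \<psi> (\<phi> x) = x)))"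

definition borel_subgroup :: "nat \<Rightarrow> 'k::field mat set \<Rightarrow> 'k mat set \<Rightarrow> bool" where
  "borel_subgroup n G B \<longleftrightarrow>
     B \<subseteq> G \<and> connected_alg_group n B \<and> solvable ((GL n)\<lparr>carrier := B\<rparr>) \<and>
     (\<forall>B'. B \<subseteq> B' \<and> B' \<subseteq> G \<and> connected_alg_group n B' \<and> solvable ((GL n)\<lparr>carrier := B'\<rparr>)
        \<longrightarrow> B' = B)"

text \<open>The Lie algebra consists of the \<open>X\<close> such that \<open>1 + t X\<close> is a point of \<open>G\<close> over the dual
  numbers \<open>k[t]/(t\<^sup>2)\<close>.\<close>

definition lie_algebra :: "nat \<Rightarrow> 'k::field mat set \<Rightarrow> 'k mat set" where
  "lie_algebra n G = {X \<in> carrier_mat n n. \<forall>p \<in> vanishing_ideal n G.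
     [:0, 0, 1:] dvd peval (\<lambda>a. [:a:]) p (mat n n (\<lambda>ij. [:1\<^sub>m n $$ ij, X $$ ij:]))}"

definition Ad :: "nat \<Rightarrow> 'a::comm_ring_1 mat \<Rightarrow> 'a mat \<Rightarrow> 'a mat" where
  "Ad n g X = g * X * inv\<^bsub>GL n\<^esub> g"

section \<open>Loop groups and loop algebras\<close>

text \<open>\<open>F\<close> is \<open>'k fls\<close>, with \<open>fls_const\<close> the inclusion of \<open>'k\<close>.
  The points of \<open>G\<close> over \<open>F\<close>:\<close>

definition F_points :: "nat \<Rightarrow> 'k::field mat set \<Rightarrow> 'k fls mat set" where
  "F_points n G = {x \<in> carrier (GL n). \<forall>p \<in> vanishing_ideal n G. peval fls_const p x = 0}"

definition lin_comb :: "nat \<Rightarrow> 'a::comm_ring_1 mat list \<Rightarrow> 'a vec \<Rightarrow> 'a mat" where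
  "lin_comb n bs c = mat n n (\<lambda>ij. \<Sum>l<length bs. c $ l * (bs ! l) $$ ij)"

definition lie_basis :: "nat \<Rightarrow> 'k::field mat set \<Rightarrow> 'k mat list \<Rightarrow> bool" where
  "lie_basis n G bs \<longleftrightarrow> set bs \<subseteq> lie_algebra n G \<and>
     bij_betw (lin_comb n bs) (carrier_vec (length bs)) (lie_algebra n G)"

text \<open>A basis \<open>bs\<close> of the Lie algebra identifies its base change to \<open>F\<close> with the \<open>F\<close>-span of
  \<open>bs\<close> in the matrices over \<open>F\<close>.\<close>

definition F_comb :: "nat \<Rightarrow> 'k::field mat list \<Rightarrow> 'k fls vec \<Rightarrow> 'k fls mat" where
  "F_comb n bs = lin_comb n (map (map_mat fls_const) bs)"

definition gF :: "nat \<Rightarrow> 'k::field mat list \<Rightarrow> 'k fls mat set" where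
  "gF n bs = F_comb n bs ` carrier_vec (length bs)"

definition gA :: "nat \<Rightarrow> 'k::field mat list \<Rightarrow> 'k fls mat set" where
  "gA n bs = F_comb n bs ` {c \<in> carrier_vec (length bs). \<forall>l<length bs. c $ l \<in> range fps_to_fls}"

definition F_coords :: "nat \<Rightarrow> 'k::field mat list \<Rightarrow> 'k fls mat \<Rightarrow> 'k fls vec" where
  "F_coords n bs = the_inv_into (carrier_vec (length bs)) (F_comb n bs)"

text \<open>Subalgebra means Lie subalgebra over \<open>'k\<close>.\<close>

definition lie_subalgebra :: "nat \<Rightarrow> 'k::field mat list \<Rightarrow> 'k fls mat set \<Rightarrow> bool" where
  "lie_subalgebra n bs \<pp> \<longleftrightarrow> \<pp> \<subseteq> gF n bs \<and> 0\<^sub>m n n \<in> \<pp> \<and>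
     (\<forall>X \<in> \<pp>. \<forall>Y \<in> \<pp>. X + Y \<in> \<pp> \<and> X * Y - Y * X \<in> \<pp>) \<and>
     (\<forall>a. \<forall>X \<in> \<pp>. fls_const a \<cdot>\<^sub>m X \<in> \<pp>)"

text \<open>The map \<open>map_mat (\<lambda>a. fls_nth a 0)\<close> is reduction at \<open>\<pi> = 0\<close>.\<close>

definition iwahori :: "nat \<Rightarrow> 'k::field mat set \<Rightarrow> 'k mat list \<Rightarrow> 'k fls mat set \<Rightarrow> bool" where
  "iwahori n G bs \<ii> \<longleftrightarrow> (\<exists>B. \<exists>g \<in> F_points n G. borel_subgroup n G B \<and>
     \<ii> = Ad n g ` {X \<in> gA n bs. map_mat (\<lambda>a. fls_nth a 0) X \<in> lie_algebra n B})"

definition parahoric :: "nat \<Rightarrow> 'k::field mat set \<Rightarrow> 'k mat list \<Rightarrow> 'k fls mat set \<Rightarrow> bool" where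
  "parahoric n G bs \<pp> \<longleftrightarrow> lie_subalgebra n bs \<pp> \<and> (\<exists>\<ii>. iwahori n G bs \<ii> \<and> \<ii> \<subseteq> \<pp>)"

definition affine_flag_manifold ::
    "nat \<Rightarrow> 'k::field mat set \<Rightarrow> 'k mat list \<Rightarrow> 'k fls mat set set \<Rightarrow> bool" where
  "affine_flag_manifold n G bs \<P> \<longleftrightarrow> (\<exists>\<pp>. parahoric n G bs \<pp> \<and> \<pp> \<noteq> gF n bs \<and>
     \<P> = {Ad n g ` \<pp> | g. g \<in> F_points n G})"

definition containing :: "'a \<Rightarrow> 'a set set \<Rightarrow> 'a set set" where
  "containing N \<P> = {\<pp> \<in> \<P>. N \<in> \<pp>}"

section \<open>The group of adjoint loops and rotations\<close>

text \<open>The adjoint form is realized as the image of the adjoint representation, written in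
  matrices with respect to \<open>bs\<close>. Since \<open>G\<close> is semisimple, the scheme-theoretic kernel of the
  adjoint representation is the scheme-theoretic centre in every characteristic, so this
  image is the quotient of \<open>G\<close> by its centre.\<close>

definition G_ad :: "nat \<Rightarrow> 'k::field mat set \<Rightarrow> 'k mat list \<Rightarrow> 'k mat set" where
  "G_ad n G bs = {a \<in> carrier_mat (length bs) (length bs). \<exists>x \<in> G.
     \<forall>c \<in> carrier_vec (length bs). Ad n x (lin_comb n bs c) = lin_comb n bs (a *\<^sub>v c)}"

text \<open>Loop rotation: the automorphism of \<open>F\<close> that scales \<open>\<pi>\<^sup>m\<close> by the \<open>m\<close>-th power of \<open>s\<close>.\<close>

definition rot :: "'k::field \<Rightarrow> 'k fls \<Rightarrow> 'k fls" where
  "rot s f = Abs_fls (\<lambda>m. s powi m * fls_nth f m)"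

lemma fls_nth_rot [simp]: "fls_nth (rot s f) m = s powi m * fls_nth f m"
proof -
  have "\<forall>\<^sub>\<infinity>j::nat. s powi (- int j) * fls_nth f (- int j) = 0"
    using MOST_fls_neg_nth_eq_0[of f] by (rule MOST_mono) auto
  then show ?thesis unfolding rot_def by (simp add: Abs_fls_inverse)
qed

definition Gm :: "'k::field monoid" where
  "Gm = \<lparr>carrier = UNIV - {0}, monoid.mult = (*), one = 1\<rparr>"

text \<open>Elements of the first factor act on the base change of the Lie algebra through
  coordinates; \<open>G_ad\<close> sits in \<open>GL (length bs)\<close> with equations over \<open>'k\<close>, so rotation acts
  on its \<open>F\<close>-points entrywise.\<close>

definition Q_group :: "nat \<Rightarrow> 'k::field mat set \<Rightarrow> 'k mat list \<Rightarrow> ('k fls mat \<times> 'k) monoid" where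
  "Q_group n G bs =
     \<lparr>carrier = F_points (length bs) (G_ad n G bs) \<times> (UNIV - {0}),
      monoid.mult = (\<lambda>(a, s) (c, t). (a * map_mat (rot s) c, s * t)),
      one = (1\<^sub>m (length bs), 1)\<rparr>"

definition Q_act :: "nat \<Rightarrow> 'k::field mat list \<Rightarrow> 'k fls mat \<times> 'k \<Rightarrow> 'k fls mat \<Rightarrow> 'k fls mat" where
  "Q_act n bs q X = F_comb n bs (fst q *\<^sub>v F_coords n bs (map_mat (rot (snd q)) X))"

text \<open>A homomorphism to \<open>Q_group\<close> is algebraic if it is a morphism of ind-varieties: the pole
  orders are bounded uniformly, and all coefficients, as well as the second component, are
  regular functions on the punctured line. The condition on the inverse of the first
  component is automatic for a homomorphism.\<close>

definition regular_on_Gm :: "('k::field \<Rightarrow> 'k) \<Rightarrow> bool" where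
  "regular_on_Gm h \<longleftrightarrow> (\<exists>q. \<exists>e::nat. \<forall>t. t \<noteq> 0 \<longrightarrow> h t = poly q t / t ^ e)"

definition Q_hom ::
    "nat \<Rightarrow> 'k::field mat set \<Rightarrow> 'k mat list \<Rightarrow> ('k \<Rightarrow> 'k fls mat \<times> 'k) \<Rightarrow> bool" where
  "Q_hom n G bs f \<longleftrightarrow> f \<in> hom Gm (Q_group n G bs) \<and>
     regular_on_Gm (\<lambda>t. snd (f t)) \<and>
     (\<forall>i<length bs. \<forall>j<length bs.
        (\<exists>M. \<forall>t. t \<noteq> 0 \<longrightarrow> (\<forall>m<M. fls_nth (fst (f t) $$ (i, j)) m = 0)) \<and>
        (\<forall>m. regular_on_Gm (\<lambda>t. fls_nth (fst (f t) $$ (i, j)) m)))"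

definition almost_commutes ::
    "nat \<Rightarrow> 'k::field mat list \<Rightarrow> ('k \<Rightarrow> 'k fls mat \<times> 'k) \<Rightarrow> 'k fls mat \<Rightarrow> bool" where
  "almost_commutes n bs f N \<longleftrightarrow> (\<exists>s::int. s \<noteq> 0 \<and>
     (\<forall>t. t \<noteq> 0 \<longrightarrow> Q_act n bs (f t) N = fls_const (t powi s) \<cdot>\<^sub>m N))"

text \<open>The map \<open>f\<close> acts on a set \<open>\<P>\<close> of subspaces. In small characteristic this is a genuine
  condition on a \<open>G(F)\<close>-conjugacy class of parahoric subalgebras: if the characteristic is 2 then
  the centre of \<open>sl\<^sub>2(F)\<close> is \<open>F\<close> times the identity, and adding the line of
  \<open>(\<pi>\<^sup>-\<^sup>1 + \<pi>\<^sup>-\<^sup>2) 1\<close> to an Iwahori subalgebra gives a subalgebra that rotations move out of its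
  conjugacy class.\<close>

definition preserves ::
    "nat \<Rightarrow> 'k::field mat list \<Rightarrow> ('k \<Rightarrow> 'k fls mat \<times> 'k) \<Rightarrow> 'k fls mat set set \<Rightarrow> bool" where
  "preserves n bs f \<P> \<longleftrightarrow> (\<forall>t. t \<noteq> 0 \<longrightarrow> (\<forall>\<pp> \<in> \<P>. Q_act n bs (f t) ` \<pp> \<in> \<P>))"

end

theory Submission
  imports Defs
begin

text \<open>If \<open>f(t) N = t\<^sup>s N\<close>, then, \<open>f(t)\<close> being injective and \<open>k\<close>-linear and parahoric subalgebras
  being \<open>k\<close>-subspaces, \<open>N \<in> f(t) \<pp>\<close> is equivalent to \<open>t\<^sup>s N \<in> f(t) \<pp>\<close>, hence to \<open>N \<in> \<pp>\<close>.

  The coordinates that define the action only make sense on \<open>\<gg>\<^sub>F\<close>, so it is needed that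
  \<open>Ad(g)\<close> preserves \<open>\<gg>\<^sub>F\<close> for \<open>g \<in> G(F)\<close>. The statement that \<open>x b adj(x)\<close> lies in the span of the
  basis, for every \<open>b\<close> in the basis, is a system of polynomial equations in \<open>x\<close> over \<open>k\<close>; it holds on
  \<open>G\<close>, hence on the \<open>F\<close>-points of \<open>G\<close>.\<close>

unbundle no Formal_Power_Series.fps_syntax

section \<open>Evaluation and substitution of polynomials in matrix entries\<close>

definition mon_eval :: "(nat \<times> nat \<Rightarrow>\<^sub>0 nat) \<Rightarrow> 'a::comm_ring_1 mat \<Rightarrow> 'a" where
  "mon_eval u X = (\<Prod>v \<in> Poly_Mapping.keys u. (X $$ v) ^ Poly_Mapping.lookup u v)"

text \<open>The extra factors have exponent 0. This lets monomials with different supports be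
  compared over one common index set.\<close>

lemma mon_eval_superset:
  assumes "finite S" "Poly_Mapping.keys u \<subseteq> S"
  shows "mon_eval u X = (\<Prod>v\<in>S. (X $$ v) ^ Poly_Mapping.lookup u v)"
  unfolding mon_eval_def using assms
  by (intro prod.mono_neutral_left) (auto simp: in_keys_iff)

lemma mon_eval_0 [simp]: "mon_eval 0 X = 1"
  by (simp add: mon_eval_def)

lemma mon_eval_add: "mon_eval (u + w) X = mon_eval u X * mon_eval w X"
proof -
  define S where "S = Poly_Mapping.keys u \<union> Poly_Mapping.keys w"
  have "finite S" "Poly_Mapping.keys u \<subseteq> S" "Poly_Mapping.keys w \<subseteq> S" "Poly_Mapping.keys (u + w) \<subseteq> S"
    using Poly_Mapping.keys_add[of u w] by (auto simp: S_def)
  then show ?thesis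
    by (simp add: mon_eval_superset lookup_add power_add prod.distrib)
qed

lemma peval_mon_eval:
  "peval h p X = (\<Sum>u \<in> Poly_Mapping.keys p. h (Poly_Mapping.lookup p u) * mon_eval u X)"
  by (simp add: peval_def mon_eval_def)

lemma peval_0 [simp]: "peval h 0 X = 0"
  by (simp add: peval_def)

text \<open>Every finitely supported map is the finite sum of its one-point restrictions.\<close>

lemma poly_mapping_single_induct [case_names zero single plus]:
  fixes p :: "'b \<Rightarrow>\<^sub>0 'c::comm_monoid_add"
  assumes "P 0" "\<And>u c. P (Poly_Mapping.single u c)" "\<And>p q. P p \<Longrightarrow> P q \<Longrightarrow> P (p + q)"
  shows "P p"
proof -
  have "P (\<Sum>u\<in>S. Poly_Mapping.single u (Poly_Mapping.lookup p u))" if "finite S" for S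
    using that by induction (auto intro: assms)
  moreover have "(\<Sum>u\<in>Poly_Mapping.keys p. Poly_Mapping.single u (Poly_Mapping.lookup p u)) = p"
    by (rule poly_mapping_eqI) (simp add: lookup_sum lookup_single when_def in_keys_iff)
  ultimately show ?thesis by (metis finite_keys)
qed

context comm_ring_hom
begin

lemma peval_superset:
  assumes "finite S" "Poly_Mapping.keys p \<subseteq> S"
  shows "peval hom p X = (\<Sum>u\<in>S. hom (Poly_Mapping.lookup p u) * mon_eval u X)"
  unfolding peval_mon_eval using assms
  by (intro sum.mono_neutral_left) (auto simp: in_keys_iff)

lemma peval_add: "peval hom (p + q) X = peval hom p X + peval hom q X"
proof -
  define S where "S = Poly_Mapping.keys p \<union> Poly_Mapping.keys q"
  have "finite S" "Poly_Mapping.keys p \<subseteq> S" "Poly_Mapping.keys q \<subseteq> S" "Poly_Mapping.keys (p + q) \<subseteq> S"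
    using Poly_Mapping.keys_add[of p q] by (auto simp: S_def)
  then show ?thesis
    by (simp add: peval_superset lookup_add hom_add distrib_right sum.distrib)
qed

lemma peval_single: "peval hom (Poly_Mapping.single u c) X = hom c * mon_eval u X"
  by (subst peval_superset[of "{u}"]) auto

text \<open>Both sides are additive in \<open>p\<close> and in \<open>q\<close>, so two inductions
  reduce the claim to single terms, where it is \<open>mon_eval_add\<close>.\<close>

lemma peval_mult: "peval hom (p * q) X = peval hom p X * peval hom q X"
proof (induction p rule: poly_mapping_single_induct)
  case (single u c)
  show ?case
    by (induction q rule: poly_mapping_single_induct)
      (simp_all add: mult_single peval_single mon_eval_add hom_mult peval_add distrib_left
        mult.assoc mult.left_commute)
qed (simp_all add: peval_add distrib_right)

lemma peval_hom: "comm_ring_hom (\<lambda>p. peval hom p X)"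
  using peval_single[of 0 1 X] by unfold_locales (simp_all add: peval_add peval_mult)

lemma hom_peval:
  assumes "comm_ring_hom h" "p \<in> pols n" "X \<in> carrier_mat n n"
  shows "hom (peval h p X) = peval (hom \<circ> h) p (map_mat hom X)"
proof -
  \<comment> \<open>\<open>map_mat\<close> commutes with indexing only inside the dimensions of
    \<open>X\<close>; \<open>p \<in> pols n\<close> keeps \<open>v\<close> in that range.\<close>
  have "hom (X $$ v) = map_mat hom X $$ v" if "u \<in> Poly_Mapping.keys p" "v \<in> Poly_Mapping.keys u" for u v
    using that assms by (cases v) (fastforce simp: pols_def)
  then show ?thesis
    by (simp add: peval_def hom_sum hom_mult hom_prod hom_power)
qed

end

text \<open>The generic matrix \<open>gen_mat\<close> reduces substitution to evaluation at matrices over the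
  polynomial ring.\<close>

definition mconst :: "'k::comm_ring_1 \<Rightarrow> 'k mpol" where
  "mconst c = Poly_Mapping.single 0 c"

definition mvar :: "nat \<times> nat \<Rightarrow> 'k::comm_ring_1 mpol" where
  "mvar v = Poly_Mapping.single (Poly_Mapping.single v 1) 1"

definition gen_mat :: "nat \<Rightarrow> 'k::comm_ring_1 mpol mat" where
  "gen_mat n = mat n n mvar"

lemma gen_mat_carrier [simp]: "gen_mat n \<in> carrier_mat n n"
  and dim_gen_mat [simp]: "dim_row (gen_mat n) = n" "dim_col (gen_mat n) = n"
  by (simp_all add: gen_mat_def)

lemma mconst_hom: "comm_ring_hom (mconst :: 'k::comm_ring_1 \<Rightarrow> _)"
  by unfold_locales (simp_all add: mconst_def single_add mult_single)

context comm_ring_hom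
begin

lemma peval_mconst [simp]: "peval hom (mconst c) X = hom c"
  by (simp add: mconst_def peval_single)

lemma peval_mvar [simp]: "peval hom (mvar v) X = X $$ v"
  by (simp add: mvar_def peval_single mon_eval_def)

lemma map_peval_gen_mat:
  "X \<in> carrier_mat n n \<Longrightarrow> map_mat (\<lambda>p. peval hom p X) (gen_mat n) = X"
  by (rule eq_matI) (auto simp: gen_mat_def)

lemma map_peval_mconst: "map_mat (\<lambda>p. peval hom p X) (map_mat mconst Y) = map_mat hom Y"
  by (rule eq_matI) auto

text \<open>This is \<open>hom_peval\<close> for the homomorphism "evaluate at \<open>X\<close>",
  whose composite with \<open>mconst\<close> is \<open>hom\<close>.\<close>

lemma peval_subst:
  assumes "p \<in> pols n" "M \<in> carrier_mat n n"
  shows "peval hom (peval mconst p M) X = peval hom p (map_mat (\<lambda>q. peval hom q X) M)"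
proof -
  interpret ev: comm_ring_hom "\<lambda>p. peval hom p X" by (rule peval_hom)
  show ?thesis
    using ev.hom_peval[OF mconst_hom assms] by (simp add: o_def)
qed

end

section \<open>Closure properties of polynomials in the entries of an \<open>n\<close> by
  \<open>n\<close> matrix\<close>

lemma pols_mconst [simp]: "mconst c \<in> pols n"
  by (simp add: mconst_def pols_def)

lemma pols_mvar: "v \<in> {..<n} \<times> {..<n} \<Longrightarrow> mvar v \<in> pols n"
  by (auto simp: mvar_def pols_def)

lemma pols_0 [simp]: "0 \<in> pols n" and pols_1 [simp]: "1 \<in> pols n"
  by (simp_all add: pols_def)

lemma pols_uminus: "p \<in> pols n \<Longrightarrow> - p \<in> pols n"
  by (simp add: pols_def)

lemma pols_add: "p \<in> pols n \<Longrightarrow> q \<in> pols n \<Longrightarrow> p + q \<in> pols n"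
  using Poly_Mapping.keys_add[of p q] by (auto simp: pols_def)

lemma pols_diff: "p \<in> pols n \<Longrightarrow> q \<in> pols n \<Longrightarrow> p - q \<in> pols n" for p :: "'k::comm_ring_1 mpol"
  using pols_add[of p n "- q"] pols_uminus[of q n] by simp

lemma pols_mult:
  assumes "p \<in> pols n" "q \<in> pols n"
  shows "p * q \<in> pols n"
  unfolding pols_def
proof (intro CollectI ballI subsetI)
  fix u v
  assume "u \<in> Poly_Mapping.keys (p * q)" and v: "v \<in> Poly_Mapping.keys u"
  then obtain a b where ab: "a \<in> Poly_Mapping.keys p" "b \<in> Poly_Mapping.keys q" "u = a + b"
    using Poly_Mapping.keys_mult[of p q] by blast
  have "v \<in> Poly_Mapping.keys a \<union> Poly_Mapping.keys b"
    using v ab(3) Poly_Mapping.keys_add[of a b] by auto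
  with ab(1,2) assms show "v \<in> {..<n} \<times> {..<n}" unfolding pols_def by blast
qed

lemma pols_sum: "(\<And>i. i \<in> I \<Longrightarrow> p i \<in> pols n) \<Longrightarrow> (\<Sum>i\<in>I. p i) \<in> pols n"
  by (induction I rule: infinite_finite_induct) (auto intro: pols_add)

lemma pols_prod: "(\<And>i. i \<in> I \<Longrightarrow> p i \<in> pols n) \<Longrightarrow> (\<Prod>i\<in>I. p i) \<in> pols n"
  for p :: "_ \<Rightarrow> 'k::comm_ring_1 mpol"
  by (induction I rule: infinite_finite_induct) (auto intro: pols_mult)

lemma pols_power: "p \<in> pols n \<Longrightarrow> p ^ e \<in> pols n" for p :: "'k::comm_ring_1 mpol"
  by (induction e) (auto intro: pols_mult)

definition pols_mat :: "nat \<Rightarrow> 'k::zero mpol mat \<Rightarrow> bool" where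
  "pols_mat n M \<longleftrightarrow> (\<forall>i<dim_row M. \<forall>j<dim_col M. M $$ (i, j) \<in> pols n)"

lemma pols_peval_mconst:
  assumes "p \<in> pols n" "pols_mat m M" "M \<in> carrier_mat n n"
  shows "peval mconst p M \<in> pols m"
  unfolding peval_def
proof (intro pols_sum pols_mult pols_prod pols_power pols_mconst)
  fix u v assume "u \<in> Poly_Mapping.keys p" "v \<in> Poly_Mapping.keys u"
  with assms(1) have "v \<in> {..<n} \<times> {..<n}" unfolding pols_def by blast
  then have "fst v < n" "snd v < n" by auto
  with assms(2,3) show "M $$ v \<in> pols m" by (cases v) (auto simp: pols_mat_def)
qed

lemma pols_gen_mat: "pols_mat n (gen_mat n)"
  by (auto simp: gen_mat_def pols_mat_def pols_mvar)

lemma pols_mat_mconst: "pols_mat n (map_mat mconst Y)"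
  by (auto simp: pols_mat_def)

lemma pols_mat_mult:
  assumes "pols_mat n M" "pols_mat n M'" "dim_col M = dim_row M'"
  shows "pols_mat n (M * M')"
  using assms by (auto simp: pols_mat_def scalar_prod_def intro!: pols_sum pols_mult)

lemma pols_det:
  fixes M :: "'k::comm_ring_1 mpol mat"
  assumes "pols_mat n M"
  shows "det M \<in> pols n"
proof -
  have "M $$ (i, p i) \<in> pols n"
    if "p permutes {0..<dim_row M}" "i < dim_row M" "dim_row M = dim_col M" for p i
  proof -
    have "p i < dim_row M" using permutes_in_image[OF that(1), of i] that(2) by auto
    with assms that show ?thesis by (auto simp: pols_mat_def)
  qed
  then show ?thesis
    by (auto simp: Determinant.det_def sign_def intro!: pols_sum pols_mult pols_prod pols_uminus)
qed

lemma pols_adj_mat: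
  fixes M :: "'k::comm_ring_1 mpol mat"
  assumes "pols_mat n M" "M \<in> carrier_mat m m"
  shows "pols_mat n (adj_mat M)"
proof -
  have "pols_mat n (mat_delete M i j)" if "i < m" "j < m" for i j
  proof -
    have "M $$ (a, b) \<in> pols n" if "a < m" "b < m" for a b
      using that assms by (auto simp: pols_mat_def)
    then show ?thesis
      using assms(2) by (auto simp: pols_mat_def mat_delete_def)
  qed
  then show ?thesis
    unfolding pols_mat_def[of n "adj_mat M"] using assms(2)
    by (auto simp: adj_mat_def cofactor_def
        intro!: pols_mult pols_power pols_uminus pols_det)
qed

text \<open>The entries of the adjugate are signed minors. Unlike the inverse, it is therefore
  polynomial in the entries and compatible with evaluating a generic matrix.\<close>

lemma (in comm_ring_hom) hom_adj_mat:
  assumes "M \<in> carrier_mat m m"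
  shows "map_mat hom (adj_mat M) = adj_mat (map_mat hom M)"
proof (rule eq_matI)
  fix i j assume "i < dim_row (adj_mat (map_mat hom M))" "j < dim_col (adj_mat (map_mat hom M))"
  then have ij: "i < m" "j < m" using assms by (auto simp: adj_mat_def)
  have "map_mat hom (mat_delete M j i) = mat_delete (map_mat hom M) j i"
    using ij assms by (intro eq_matI) (auto simp: mat_delete_def)
  then show "map_mat hom (adj_mat M) $$ (i, j) = adj_mat (map_mat hom M) $$ (i, j)"
    using ij assms by (auto simp: adj_mat_def cofactor_def hom_mult hom_power hom_uminus hom_det[symmetric] simp del: hom_det)
qed (auto simp: adj_mat_def)

section \<open>Matrix groups and linear combinations of matrices\<close>

lemma ring_mat_monoid: "monoid (ring_mat TYPE('a::comm_ring_1) n ())"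
  using semiring_mat[of n "()", where 'a='a] by (simp add: Ring.semiring_def)

lemma GL_group: "group (GL n :: 'a::comm_ring_1 mat monoid)"
  by (rule monoid.units_group[OF ring_mat_monoid])

lemma GL_mult [simp]: "x \<otimes>\<^bsub>GL n\<^esub> y = x * y" and GL_one [simp]: "\<one>\<^bsub>GL n\<^esub> = 1\<^sub>m n"
  by (simp_all add: units_of_mult units_of_one ring_mat_simps)

lemma GL_carrier_iff:
  "x \<in> carrier (GL n) \<longleftrightarrow> x \<in> carrier_mat n n \<and> (\<exists>y\<in>carrier_mat n n. y * x = 1\<^sub>m n \<and> x * y = 1\<^sub>m n)"
  by (auto simp: units_of_carrier Units_def ring_mat_simps)

lemma GL_carrier_mat: "x \<in> carrier (GL n) \<Longrightarrow> x \<in> carrier_mat n n"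
  by (simp add: GL_carrier_iff)

lemma GL_inv:
  assumes "x \<in> carrier (GL n)"
  shows "inv\<^bsub>GL n\<^esub> x \<in> carrier_mat n n" "x * inv\<^bsub>GL n\<^esub> x = 1\<^sub>m n" "inv\<^bsub>GL n\<^esub> x * x = 1\<^sub>m n"
  using group.inv_closed[OF GL_group assms] group.r_inv[OF GL_group assms]
    group.l_inv[OF GL_group assms] by (simp_all add: GL_carrier_mat)

lemma adj_mat_eq_GL_inv:
  assumes "x \<in> carrier (GL n)"
  shows "adj_mat x = det x \<cdot>\<^sub>m inv\<^bsub>GL n\<^esub> x"
proof -
  note x = GL_carrier_mat[OF assms] and inv = GL_inv[OF assms]
  have "adj_mat x = (adj_mat x * x) * inv\<^bsub>GL n\<^esub> x"
    using x inv adj_mat(1)[OF x] by (simp add: assoc_mult_mat[OF adj_mat(1)[OF x] x inv(1)])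
  then show ?thesis
    using inv(1) by (simp add: adj_mat(3)[OF x] mult_smult_assoc_mat[where nr = n and n = n and nc = n])
qed

lemma smult_smult_mat: "a \<cdot>\<^sub>m (b \<cdot>\<^sub>m X) = (a * b) \<cdot>\<^sub>m X" for a :: "'a::semigroup_mult"
  by (rule eq_matI) (auto simp: mult.assoc)

lemma one_smult_mat: "(1::'a::monoid_mult) \<cdot>\<^sub>m X = X"
  by (rule eq_matI) auto

text \<open>Clears denominators in \<open>Ad\<close>: the left side is polynomial in
  \<open>x\<close>, and the scalar \<open>det x\<close> does not affect membership in a linear
  span.\<close>

lemma mult_adj_mat_eq_Ad:
  assumes x: "x \<in> carrier (GL n)" and X: "X \<in> carrier_mat n n"
  shows "x * X * adj_mat x = det x \<cdot>\<^sub>m Ad n x X"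
  using GL_carrier_mat[OF x] X GL_inv(1)[OF x]
  by (simp add: Ad_def adj_mat_eq_GL_inv[OF x] mult_smult_distrib[OF mult_carrier_mat])

lemma Ad_eq_mult_adj_mat:
  assumes x: "x \<in> carrier (GL n)" and X: "X \<in> carrier_mat n n"
  shows "Ad n x X = det (inv\<^bsub>GL n\<^esub> x) \<cdot>\<^sub>m (x * X * adj_mat x)"
proof -
  have "det (inv\<^bsub>GL n\<^esub> x) * det x = 1"
    using GL_inv[OF x] GL_carrier_mat[OF x] det_mult[of "inv\<^bsub>GL n\<^esub> x" n x] by simp
  then show ?thesis
    by (simp add: mult_adj_mat_eq_Ad[OF x X] smult_smult_mat one_smult_mat)
qed

section \<open>Linear combinations of matrices and dual functionals\<close>

lemma dim_lin_comb [simp]: "dim_row (lin_comb n bs c) = n" "dim_col (lin_comb n bs c) = n"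
  and lin_comb_carrier [simp]: "lin_comb n bs c \<in> carrier_mat n n"
  by (simp_all add: lin_comb_def)

lemma lin_comb_index:
  "v \<in> {..<n} \<times> {..<n} \<Longrightarrow> lin_comb n bs c $$ v = (\<Sum>l<length bs. c $ l * (bs ! l) $$ v)"
  by (auto simp: lin_comb_def)

lemma map_mat_nth_index:
  assumes "set bs \<subseteq> carrier_mat n n" "l < length bs" "v \<in> {..<n} \<times> {..<n}"
  shows "map_mat h (bs ! l) $$ v = h (bs ! l $$ v)"
proof -
  have "bs ! l \<in> carrier_mat n n" using assms(1,2) by auto
  then show ?thesis using assms(3) by auto
qed

lemma lin_comb_smult:
  "c \<in> carrier_vec (length bs) \<Longrightarrow> lin_comb n bs (a \<cdot>\<^sub>v c) = a \<cdot>\<^sub>m lin_comb n bs c"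
  by (rule eq_matI) (auto simp: lin_comb_index sum_distrib_left mult.assoc)

lemma mult_lin_comb_mult:
  assumes "A \<in> carrier_mat n n" "C \<in> carrier_mat n n" "set bs \<subseteq> carrier_mat n n"
  shows "A * lin_comb n bs c * C = lin_comb n (map (\<lambda>b. A * b * C) bs) c"
proof (rule eq_matI)
  fix i j assume "i < dim_row (lin_comb n (map (\<lambda>b. A * b * C) bs) c)"
    "j < dim_col (lin_comb n (map (\<lambda>b. A * b * C) bs) c)"
  then have ij: "i < n" "j < n" by auto
  have entry: "(A * B * C) $$ (i, j) = (\<Sum>q<n. \<Sum>p<n. A $$ (i, p) * B $$ (p, q) * C $$ (q, j))"
    if "B \<in> carrier_mat n n" for B
    using that assms ij
    by (simp add: scalar_prod_def sum_distrib_right atLeast0LessThan del: assoc_mult_mat)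
  have b: "bs ! l \<in> carrier_mat n n" if "l < length bs" for l
    using that assms(3) by auto
  have "(A * lin_comb n bs c * C) $$ (i, j) =
      (\<Sum>q<n. \<Sum>p<n. \<Sum>l<length bs. c $ l * (A $$ (i, p) * (bs ! l) $$ (p, q) * C $$ (q, j)))"
    by (simp add: entry lin_comb_index sum_distrib_left sum_distrib_right mult_ac)
  also have "\<dots> = (\<Sum>q<n. \<Sum>l<length bs. \<Sum>p<n. c $ l * (A $$ (i, p) * (bs ! l) $$ (p, q) * C $$ (q, j)))"
    by (intro sum.cong refl sum.swap)
  also have "\<dots> = (\<Sum>l<length bs. \<Sum>q<n. \<Sum>p<n. c $ l * (A $$ (i, p) * (bs ! l) $$ (p, q) * C $$ (q, j)))"
    by (rule sum.swap)
  also have "\<dots> = (\<Sum>l<length bs. c $ l * (A * bs ! l * C) $$ (i, j))"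
    by (intro sum.cong refl) (simp add: entry b sum_distrib_left)
  finally show "(A * lin_comb n bs c * C) $$ (i, j) = lin_comb n (map (\<lambda>b. A * b * C) bs) c $$ (i, j)"
    using ij by (simp add: lin_comb_index)
qed (use assms in auto)

text \<open>Substitute the expansion of each \<open>cs ! m\<close> and exchange the two
  sums.\<close>

lemma lin_comb_lin_combs:
  fixes d :: "nat \<Rightarrow> 'a::comm_ring_1 vec"
  assumes "\<And>m. m < length cs \<Longrightarrow> cs ! m = lin_comb n bs (d m)"
  shows "lin_comb n cs c = lin_comb n bs (vec (length bs) (\<lambda>l. \<Sum>m<length cs. c $ m * d m $ l))"
proof (rule eq_matI)
  fix i j assume "i < dim_row (lin_comb n bs (vec (length bs) (\<lambda>l. \<Sum>m<length cs. c $ m * d m $ l)))"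
    "j < dim_col (lin_comb n bs (vec (length bs) (\<lambda>l. \<Sum>m<length cs. c $ m * d m $ l)))"
  then have ij: "i < n" "j < n" by auto
  have "lin_comb n cs c $$ (i, j) =
      (\<Sum>m<length cs. \<Sum>l<length bs. c $ m * d m $ l * (bs ! l) $$ (i, j))"
    using ij by (simp add: lin_comb_index assms sum_distrib_left mult.assoc)
  also have "\<dots> = (\<Sum>l<length bs. \<Sum>m<length cs. c $ m * d m $ l * (bs ! l) $$ (i, j))"
    by (rule sum.swap)
  finally show "lin_comb n cs c $$ (i, j) =
      lin_comb n bs (vec (length bs) (\<lambda>l. \<Sum>m<length cs. c $ m * d m $ l)) $$ (i, j)"
    using ij by (simp add: lin_comb_index sum_distrib_right)
qed auto

text \<open>The hypothesis says that the functions \<open>v 0\<close>, ..., \<open>v (d - 1)\<close>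
  are linearly independent on \<open>I\<close>. The dual functionals are finite sums with
  coefficients in the field, so they keep their meaning after base change. They are built by
  induction on \<open>d\<close>, as in Gram-Schmidt orthogonalization.\<close>

lemma dual_family_exists:
  fixes I :: "'i set" and d :: nat and v :: "nat \<Rightarrow> 'i \<Rightarrow> 'k::field"
  assumes "finite I" and "\<And>c. (\<And>i. i \<in> I \<Longrightarrow> (\<Sum>l<d. c l * v l i) = 0) \<Longrightarrow> \<forall>l<d. c l = 0"
  shows "\<exists>w. \<forall>l<d. \<forall>m<d. (\<Sum>i\<in>I. w l i * v m i) = (if l = m then 1 else 0)"
  using assms(2)
proof (induction d)
  case (Suc d)
  have "\<forall>l<d. c l = 0" if "\<And>i. i \<in> I \<Longrightarrow> (\<Sum>l<d. c l * v l i) = 0" for c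
  proof -
    \<comment> \<open>A relation among the first \<open>d\<close> functions, padded by a zero
      coefficient, is one among all \<open>Suc d\<close>.\<close>
    have "\<forall>l<Suc d. (if l < d then c l else 0) = 0"
      by (rule Suc.prems) (simp add: that)
    then show ?thesis by (metis less_SucI)
  qed
  from Suc.IH[OF this] obtain w
    where w: "\<And>l m. l < d \<Longrightarrow> m < d \<Longrightarrow> (\<Sum>i\<in>I. w l i * v m i) = (if l = m then 1 else 0)"
    by blast
  \<comment> \<open>\<open>u\<close> is \<open>v d\<close> minus its projection along
    \<open>w\<close> to the span of the earlier functions. If it vanished on \<open>I\<close>, that
    would be a relation with coefficient 1 at \<open>v d\<close>.\<close>
  define a where "a l = (\<Sum>i\<in>I. w l i * v d i)" for l
  define u where "u i = v d i - (\<Sum>l<d. a l * v l i)" for i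
  have "\<exists>e\<in>I. u e \<noteq> 0"
  proof (rule ccontr)
    assume "\<not> ?thesis"
    then have "\<forall>l<Suc d. (if l < d then - a l else 1) = 0"
      by (intro Suc.prems) (auto simp: u_def sum_negf)
    then show False by (metis less_irrefl lessI zero_neq_one)
  qed
  then obtain e where e: "e \<in> I" "u e \<noteq> 0" by blast
  \<comment> \<open>the coordinate \<open>e\<close> made to vanish on \<open>v 0, \<dots>, v (d - 1)\<close> and normalized on \<open>v d\<close>\<close>
  define wd where "wd i = ((if i = e then 1 else 0) - (\<Sum>l<d. w l i * v l e)) / u e" for i
  \<comment> \<open>For \<open>m < d\<close> duality collapses the inner sum to
    \<open>v m e\<close>, giving 0; for \<open>m = d\<close> the numerator is \<open>u e\<close>,
    giving 1.\<close>
  have wd: "(\<Sum>i\<in>I. wd i * v m i) = (v m e - (\<Sum>l<d. (\<Sum>i\<in>I. w l i * v m i) * v l e)) / u e" for m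
  proof -
    have "wd i * v m i = ((if i = e then v m i else 0) - (\<Sum>l<d. w l i * v m i * v l e)) / u e" for i
    proof -
      have "(\<Sum>l<d. w l i * v m i * v l e) = (\<Sum>l<d. w l i * v l e) * v m i"
        by (simp add: sum_distrib_left sum_distrib_right mult_ac)
      then show ?thesis by (simp add: wd_def left_diff_distrib)
    qed
    then have "(\<Sum>i\<in>I. wd i * v m i)
        = (\<Sum>i\<in>I. (if i = e then v m i else 0) - (\<Sum>l<d. w l i * v m i * v l e)) / u e"
      by (simp add: sum_divide_distrib)
    also have "\<dots> = (v m e - (\<Sum>i\<in>I. \<Sum>l<d. w l i * v m i * v l e)) / u e"
      using assms(1) e(1) by (simp add: sum_subtractf)
    also have "(\<Sum>i\<in>I. \<Sum>l<d. w l i * v m i * v l e) = (\<Sum>l<d. (\<Sum>i\<in>I. w l i * v m i) * v l e)"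
      by (subst sum.swap) (simp add: sum_distrib_right)
    finally show ?thesis .
  qed
  have wd_less: "(\<Sum>i\<in>I. wd i * v m i) = 0" if "m < d" for m
    using that by (simp add: wd w if_distrib[of "\<lambda>x. x * _"] cong: if_cong)
  have wd_d: "(\<Sum>i\<in>I. wd i * v d i) = 1"
    using e(2) by (simp add: wd u_def flip: a_def)
  \<comment> \<open>The old functionals may be nonzero on \<open>v d\<close>, with value
    \<open>a l\<close>; subtracting \<open>a l\<close> times \<open>wd\<close> corrects this and
    leaves their values on the earlier functions unchanged.\<close>
  define w' where "w' l i = (if l < d then w l i - a l * wd i else wd i)" for l i
  have w': "(\<Sum>i\<in>I. w' l i * v m i) = (\<Sum>i\<in>I. w l i * v m i) - a l * (\<Sum>i\<in>I. wd i * v m i)"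
    if "l < d" for l m
    using that by (simp add: w'_def left_diff_distrib sum_subtractf sum_distrib_left mult.assoc)
  have "(\<Sum>i\<in>I. w' l i * v m i) = (if l = m then 1 else 0)" if "l < Suc d" "m < Suc d" for l m
  proof (cases "l < d")
    case True
    then show ?thesis
      using that(2) by (cases "m < d") (auto simp: w' w wd_less wd_d less_Suc_eq simp flip: a_def)
  next
    case False
    then show ?thesis
      using that wd_less wd_d by (auto simp: w'_def less_Suc_eq)
  qed
  then show ?case by blast
qed simp

text \<open>Injectivity of \<open>lin_comb\<close> is linear independence of the entry functions of
  \<open>bs\<close>; \<open>w l\<close> is then the \<open>l\<close>-th coordinate functional,
  written in matrix entries.\<close>

lemma lin_comb_dual:
  fixes bs :: "'k::field mat list"
  assumes "inj_on (lin_comb n bs) (carrier_vec (length bs))"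
  obtains w where "\<And>l m. l < length bs \<Longrightarrow> m < length bs \<Longrightarrow>
    (\<Sum>v\<in>{..<n} \<times> {..<n}. w l v * (bs ! m) $$ v) = (if l = m then 1 else 0)"
proof -
  have "\<exists>w. \<forall>l<length bs. \<forall>m<length bs.
      (\<Sum>v\<in>{..<n} \<times> {..<n}. w l v * (bs ! m) $$ v) = (if l = m then 1 else 0)"
  proof (rule dual_family_exists[where v = "\<lambda>l v. (bs ! l) $$ v"])
    fix c assume c: "\<And>v. v \<in> {..<n} \<times> {..<n} \<Longrightarrow> (\<Sum>l<length bs. c l * (bs ! l) $$ v) = 0"
    have "lin_comb n bs (vec (length bs) c) = lin_comb n bs (0\<^sub>v (length bs))"
      using c by (intro eq_matI) (auto simp: lin_comb_index)
    then have "vec (length bs) c = 0\<^sub>v (length bs)"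
      using assms by (auto dest: inj_onD)
    then show "\<forall>l<length bs. c l = 0" by (metis index_vec index_zero_vec(1))
  qed simp
  then show ?thesis using that by blast
qed

context comm_ring_hom
begin

text \<open>The duality relations involve only scalars of the base ring, so their images under
  \<open>hom\<close> still read off coordinates after base change.\<close>

lemma dual_lin_comb:
  assumes w: "\<And>l m. l < length bs \<Longrightarrow> m < length bs \<Longrightarrow>
      (\<Sum>v\<in>{..<n} \<times> {..<n}. w l v * (bs ! m) $$ v) = (if l = m then 1 else 0)"
    and bs: "set bs \<subseteq> carrier_mat n n" and l: "l < length bs"
  shows "(\<Sum>v\<in>{..<n} \<times> {..<n}. hom (w l v) * lin_comb n (map (map_mat hom) bs) c $$ v) = c $ l"
proof -
  have "(\<Sum>v\<in>{..<n} \<times> {..<n}. hom (w l v) * lin_comb n (map (map_mat hom) bs) c $$ v) =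
      (\<Sum>v\<in>{..<n} \<times> {..<n}. \<Sum>m<length bs. c $ m * hom (w l v * (bs ! m) $$ v))"
    by (intro sum.cong refl) (simp add: lin_comb_index sum_distrib_left hom_mult map_mat_nth_index[OF bs]
        mult_ac del: index_map_mat)
  also have "\<dots> = (\<Sum>m<length bs. c $ m * hom (\<Sum>v\<in>{..<n} \<times> {..<n}. w l v * (bs ! m) $$ v))"
    by (subst sum.swap) (simp add: sum_distrib_left hom_sum)
  also have "\<dots> = c $ l"
    using l by (simp add: w if_distrib[of hom] if_distrib[of "\<lambda>x. _ * x"] cong: if_cong)
  finally show ?thesis .
qed

end

section \<open>The adjoint action on Lie algebras and loop algebras\<close>

lemma map_mat_id [simp]: "map_mat id = (\<lambda>X. X)" "map_mat (\<lambda>x. x) = (\<lambda>X. X)"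
  by (auto intro!: ext eq_matI)

lemma id_hom: "comm_ring_hom (id :: 'a::comm_ring_1 \<Rightarrow> 'a)"
  by unfold_locales auto

lemma const_poly_hom: "comm_ring_hom (\<lambda>a::'a::comm_ring_1. [:a:])"
  by unfold_locales (auto simp: one_pCons)

lemma fls_const_hom: "comm_ring_hom (fls_const :: 'k::field \<Rightarrow> 'k fls)"
  by unfold_locales (auto simp: fls_plus_const)

text \<open>The point \<open>1 + t X\<close> over polynomials, with \<open>t = [:0, 1:]\<close>. The
  dual numbers enter only through divisibility by \<open>[:0, 0, 1:]\<close>, the square of
  \<open>t\<close>.\<close>

lemma dual_number_mat:
  fixes X :: "'k::comm_ring_1 mat"
  assumes "X \<in> carrier_mat n n"
  shows "mat n n (\<lambda>ij. [:1\<^sub>m n $$ ij, X $$ ij:]) = 1\<^sub>m n + [:0, 1:] \<cdot>\<^sub>m map_mat (\<lambda>a. [:a:]) X"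
  using assms by (intro eq_matI) (auto simp: one_pCons)

text \<open>Conjugation by \<open>x\<close> maps \<open>G\<close> to itself. Hence if
  \<open>p\<close> vanishes on \<open>G\<close>, so does the polynomial \<open>q\<close> with
  \<open>q(Y) = p(x Y y)\<close>, where \<open>y\<close> is the inverse of \<open>x\<close>. The
  condition of \<open>q\<close> at \<open>1 + t X\<close> is the condition of \<open>p\<close> at
  \<open>1 + t Ad(x) X\<close>.\<close>

lemma Ad_lie_algebra:
  assumes G: "alg_group n G" and x: "x \<in> G" and X: "X \<in> lie_algebra n G"
  shows "Ad n x X \<in> lie_algebra n G"
proof -
  note [simp] = mult_carrier_mat[of _ n n _ n]
  have sub: "subgroup G (GL n)" using G by (simp add: alg_group_def)
  have xGL: "x \<in> carrier (GL n)" using subgroup.subset[OF sub] x by blast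
  define y where "y = inv\<^bsub>GL n\<^esub> x"
  have c [simp]: "x \<in> carrier_mat n n" "y \<in> carrier_mat n n" "X \<in> carrier_mat n n"
    using xGL GL_inv(1)[OF xGL] X by (auto simp: GL_carrier_mat y_def lie_algebra_def)
  have xy: "x * y = 1\<^sub>m n" using GL_inv(2)[OF xGL] by (simp add: y_def)
  show ?thesis
    unfolding lie_algebra_def
  proof (intro CollectI conjI ballI)
    show "Ad n x X \<in> carrier_mat n n" by (simp add: Ad_def flip: y_def)
    fix p assume p: "p \<in> vanishing_ideal n G"
    define M where "M = map_mat mconst x * gen_mat n * map_mat mconst y"
    define q where "q = peval mconst p M"
    have M: "M \<in> carrier_mat n n" by (simp add: M_def)
    have "pols_mat n M"
      unfolding M_def by (intro pols_mat_mult pols_mat_mconst pols_gen_mat) (use carrier_matD[OF c(1)] carrier_matD[OF c(2)] in auto)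
    then have q_pols: "q \<in> pols n"
      using p M by (auto simp: q_def vanishing_ideal_def intro: pols_peval_mconst)
    \<comment> \<open>Needed for two algebras: over \<open>k\<close> to see that \<open>q\<close>
      vanishes on \<open>G\<close>, and over polynomials to evaluate at
      \<open>1 + t X\<close>.\<close>
    have q: "peval h q Y = peval h p (map_mat h x * Y * map_mat h y)"
      if "comm_ring_hom h" "Y \<in> carrier_mat n n" for h :: "'a \<Rightarrow> 'b::comm_ring_1" and Y
    proof -
      interpret comm_ring_hom h by fact
      interpret ev: comm_ring_hom "\<lambda>p. peval h p Y" by (rule peval_hom)
      have "map_mat (\<lambda>p. peval h p Y) M = map_mat h x * Y * map_mat h y"
        unfolding M_def using that(2)
        by (simp add: ev.mat_hom_mult[where nr = n and n = n and nc = n] map_peval_gen_mat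
            map_peval_mconst del: assoc_mult_mat)
      then show ?thesis
        using p M by (simp add: q_def peval_subst[of p n] vanishing_ideal_def)
    qed
    have "peval id q z = 0" if "z \<in> G" for z
    proof -
      have "x * z * y \<in> G"
        using that x subgroup.m_closed[OF sub] subgroup.m_inv_closed[OF sub] by (simp add: y_def)
      moreover have "z \<in> carrier_mat n n"
        using that subgroup.subset[OF sub] by (blast intro: GL_carrier_mat)
      ultimately show ?thesis
        using p q[OF id_hom] by (simp add: vanishing_ideal_def)
    qed
    then have "q \<in> vanishing_ideal n G" using q_pols by (simp add: vanishing_ideal_def)
    then have "[:0, 0, 1:] dvd peval (\<lambda>a. [:a:]) q (mat n n (\<lambda>ij. [:1\<^sub>m n $$ ij, X $$ ij:]))"
      using X by (simp add: lie_algebra_def)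
    also have "peval (\<lambda>a. [:a:]) q (mat n n (\<lambda>ij. [:1\<^sub>m n $$ ij, X $$ ij:])) =
        peval (\<lambda>a. [:a:]) p (map_mat (\<lambda>a. [:a:]) x * mat n n (\<lambda>ij. [:1\<^sub>m n $$ ij, X $$ ij:]) *
          map_mat (\<lambda>a. [:a:]) y)"
      by (rule q[OF const_poly_hom]) simp
    also have "map_mat (\<lambda>a. [:a:]) x * mat n n (\<lambda>ij. [:1\<^sub>m n $$ ij, X $$ ij:]) * map_mat (\<lambda>a. [:a:]) y =
        mat n n (\<lambda>ij. [:1\<^sub>m n $$ ij, Ad n x X $$ ij:])"
    proof -
      interpret P: comm_ring_hom "\<lambda>a::'a. [:a:]" by (rule const_poly_hom)
      let ?m = "map_mat (\<lambda>a. [:a:])"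
      have "?m x * (1\<^sub>m n + [:0, 1:] \<cdot>\<^sub>m ?m X) * ?m y = ?m x * ?m y + [:0, 1:] \<cdot>\<^sub>m (?m x * ?m X * ?m y)"
        by (simp add: mult_add_distrib_mat[where nr = n and n = n and nc = n]
            add_mult_distrib_mat[where nr = n and n = n and nc = n]
            mult_smult_distrib[where nr = n and n = n and nc = n]
            mult_smult_assoc_mat[where nr = n and n = n and nc = n]
            right_mult_one_mat[of _ n n] del: assoc_mult_mat)
      also have "\<dots> = ?m (x * y) + [:0, 1:] \<cdot>\<^sub>m ?m (x * X * y)"
        by (simp add: P.mat_hom_mult[where nr = n and n = n and nc = n] del: assoc_mult_mat)
      finally show ?thesis
        by (simp add: dual_number_mat xy P.mat_hom_one Ad_def flip: y_def)
    qed
    finally show "[:0, 0, 1:] dvd peval (\<lambda>a. [:a:]) p (mat n n (\<lambda>ij. [:1\<^sub>m n $$ ij, Ad n x X $$ ij:]))" .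
  qed
qed

lemma lie_basis_carrier: "lie_basis n G bs \<Longrightarrow> set bs \<subseteq> carrier_mat n n"
  by (auto simp: lie_basis_def lie_algebra_def)

text \<open>To become polynomial equations, membership in the span is expressed through the dual
  functionals: a matrix lies in the span of \<open>bs\<close> exactly when it equals the combination
  of \<open>bs\<close> with the coordinates read off by \<open>w\<close>.\<close>

lemma Ad_gF:
  assumes G: "alg_group n G" and bs: "lie_basis n G bs"
    and g: "g \<in> F_points n G" and X: "X \<in> gF n bs"
  shows "Ad n g X \<in> gF n bs"
proof -
  note [simp] = mult_carrier_mat[of _ n n _ n]
  let ?m = "map_mat fls_const :: 'a mat \<Rightarrow> _" and ?I = "{..<n} \<times> {..<n}"
  interpret F: comm_ring_hom "fls_const :: 'a \<Rightarrow> 'a fls" by (rule fls_const_hom)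
  have gGL: "g \<in> carrier (GL n)" using g by (simp add: F_points_def)
  have gc [simp]: "g \<in> carrier_mat n n" "adj_mat g \<in> carrier_mat n n"
    using GL_carrier_mat[OF gGL] adj_mat(1) by auto
  have bsc: "set bs \<subseteq> carrier_mat n n" by (rule lie_basis_carrier[OF bs])
  obtain w where w: "\<And>l m. l < length bs \<Longrightarrow> m < length bs \<Longrightarrow>
      (\<Sum>v\<in>?I. w l v * (bs ! m) $$ v) = (if l = m then 1 else 0)"
    using lin_comb_dual[of n bs] bs by (auto simp: lie_basis_def bij_betw_def)
  have dual: "(\<Sum>v\<in>?I. w l v * lin_comb n bs c $$ v) = c $ l" if "l < length bs" for l c
    using comm_ring_hom.dual_lin_comb[OF id_hom w bsc that] by simp
  \<comment> \<open>The candidate coordinates over \<open>F\<close>, obtained by applying the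
    functionals \<open>w\<close> to the conjugated basis element.\<close>
  define d where "d b = vec (length bs) (\<lambda>l. \<Sum>u\<in>?I. fls_const (w l u) * (g * ?m b * adj_mat g) $$ u)" for b
  have key: "g * ?m b * adj_mat g = lin_comb n (map ?m bs) (d b)" if b: "b \<in> set bs" for b
  proof (rule eq_matI)
    have bc [simp]: "b \<in> carrier_mat n n" using b bsc by blast
    fix i j assume "i < dim_row (lin_comb n (map ?m bs) (d b))" "j < dim_col (lin_comb n (map ?m bs) (d b))"
    then have ij: "(i, j) \<in> ?I" by simp
    define T where "T = gen_mat n * map_mat mconst b * adj_mat (gen_mat n)"
    \<comment> \<open>\<open>q\<close> is the \<open>(i, j)\<close> entry of \<open>T\<close> minus its projection to the span of \<open>bs\<close> along \<open>w\<close>.\<close>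
    define q where "q = T $$ (i, j) -
      (\<Sum>l<length bs. (\<Sum>u\<in>?I. mconst (w l u) * T $$ u) * mconst ((bs ! l) $$ (i, j)))"
    have adjc: "adj_mat (gen_mat n) \<in> (carrier_mat n n :: 'a mpol mat set)" by (rule adj_mat(1)) simp
    have Tc: "T \<in> carrier_mat n n" using adjc by (simp add: T_def)
    have "pols_mat n T"
      unfolding T_def
      by (intro pols_mat_mult pols_mat_mconst pols_gen_mat pols_adj_mat[of _ _ n]) (use adjc carrier_matD[OF bc] in auto)
    then have "T $$ u \<in> pols n" if "u \<in> ?I" for u
      using that Tc by (auto simp: pols_mat_def)
    then have q_pols: "q \<in> pols n"
      unfolding q_def using ij by (intro pols_diff pols_sum pols_mult pols_mconst) auto
    have peval_q: "peval h q Y = (Y * map_mat h b * adj_mat Y) $$ (i, j) -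
        (\<Sum>l<length bs. (\<Sum>u\<in>?I. h (w l u) * (Y * map_mat h b * adj_mat Y) $$ u) * h ((bs ! l) $$ (i, j)))"
      if "comm_ring_hom h" "Y \<in> carrier_mat n n" for h :: "'a \<Rightarrow> 'b::comm_ring_1" and Y
    proof -
      interpret comm_ring_hom h by fact
      interpret ev: comm_ring_hom "\<lambda>p. peval h p Y" by (rule peval_hom)
      have T: "map_mat (\<lambda>p. peval h p Y) T = Y * map_mat h b * adj_mat Y"
        unfolding T_def using that(2) adjc
        by (simp add: ev.mat_hom_mult[where nr = n and n = n and nc = n] map_peval_gen_mat
            map_peval_mconst ev.hom_adj_mat[of _ n] del: assoc_mult_mat)
      have "peval h (T $$ u) Y = (Y * map_mat h b * adj_mat Y) $$ u" if "u \<in> ?I" for u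
        using that Tc by (auto simp flip: T)
      then show ?thesis
        using ij by (simp add: q_def ev.hom_minus ev.hom_sum ev.hom_mult)
    qed
    \<comment> \<open>Over \<open>k\<close>, \<open>T\<close> specializes to \<open>det x\<close>
      times \<open>Ad n x b\<close>, which lies in the Lie algebra and so is fixed by the
      projection.\<close>
    have "peval id q x = 0" if x: "x \<in> G" for x
    proof -
      have xGL: "x \<in> carrier (GL n)" using x G subgroup.subset by (auto simp: alg_group_def)
      have "Ad n x b \<in> lie_algebra n G" using b bs x G by (auto simp: lie_basis_def intro: Ad_lie_algebra)
      then obtain c where c: "c \<in> carrier_vec (length bs)" "Ad n x b = lin_comb n bs c"
        using bs by (auto simp: lie_basis_def bij_betw_def)
      define c' where "c' = det x \<cdot>\<^sub>v c"
      have c': "x * b * adj_mat x = lin_comb n bs c'"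
        using c by (simp add: mult_adj_mat_eq_Ad[OF xGL] lin_comb_smult c'_def)
      show ?thesis
        using peval_q[OF id_hom GL_carrier_mat[OF xGL]] ij
        by (simp add: c' dual lin_comb_index[OF ij] del: assoc_mult_mat)
    qed
    then have "q \<in> vanishing_ideal n G" using q_pols by (simp add: vanishing_ideal_def)
    then have "peval fls_const q g = 0" using g by (simp add: F_points_def)
    then have "(g * ?m b * adj_mat g) $$ (i, j) = (\<Sum>l<length bs. d b $ l * fls_const ((bs ! l) $$ (i, j)))"
      using peval_q[OF fls_const_hom gc(1)] by (simp add: d_def)
    then show "(g * ?m b * adj_mat g) $$ (i, j) = lin_comb n (map ?m bs) (d b) $$ (i, j)"
      using ij by (simp add: lin_comb_index map_mat_nth_index[OF bsc] del: index_map_mat)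
  qed (use carrier_matD[OF gc(1)] carrier_matD[OF gc(2)] in auto)
  from X obtain c where c: "c \<in> carrier_vec (length bs)" "X = lin_comb n (map ?m bs) c"
    by (auto simp: gF_def F_comb_def)
  have "g * X * adj_mat g = lin_comb n (map (\<lambda>b. g * b * adj_mat g) (map ?m bs)) c"
    unfolding c(2) using bsc by (intro mult_lin_comb_mult) auto
  also have "\<dots> = lin_comb n (map ?m bs) (vec (length bs) (\<lambda>l. \<Sum>m<length bs. c $ m * d (bs ! m) $ l))"
    using lin_comb_lin_combs[of "map (\<lambda>b. g * b * adj_mat g) (map ?m bs)" n "map ?m bs" "\<lambda>m. d (bs ! m)"]
    by (simp add: key)
  finally have "g * X * adj_mat g = lin_comb n (map ?m bs) (vec (length bs) (\<lambda>l. \<Sum>m<length bs. c $ m * d (bs ! m) $ l))"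
    (is "_ = lin_comb _ _ ?e") .
  moreover have "X \<in> carrier_mat n n" using c(2) by simp
  \<comment> \<open>Passing from the adjugate back to the inverse divides by \<open>det g\<close>,
    which is absorbed into the coordinates.\<close>
  ultimately have "Ad n g X = lin_comb n (map ?m bs) (det (inv\<^bsub>GL n\<^esub> g) \<cdot>\<^sub>v ?e)"
    by (simp add: Ad_eq_mult_adj_mat[OF gGL] lin_comb_smult del: assoc_mult_mat)
  then show ?thesis by (auto simp: gF_def F_comb_def)
qed

section \<open>The action of adjoint loops and rotations\<close>

text \<open>The summation range in \<open>fls_times_nth\<close> depends on the subdegrees, so
  multiplicativity of \<open>rot\<close> requires that they do not change.\<close>

lemma fls_subdegree_rot: "s \<noteq> 0 \<Longrightarrow> fls_subdegree (rot s f) = fls_subdegree f"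
proof (cases "f = 0")
  case True
  then have "rot s f = 0" by (intro fls_eqI) simp
  with True show ?thesis by simp
next
  case False
  then show "s \<noteq> 0 \<Longrightarrow> fls_subdegree (rot s f) = fls_subdegree f"
    by (intro fls_subdegree_eqI) (auto simp: fls_eq0_below_subdegree power_int_eq_0_iff)
qed

lemma rot_mult:
  assumes "s \<noteq> 0"
  shows "rot s (f * g) = rot s f * rot s g"
proof (rule fls_eqI)
  fix n
  \<comment> \<open>Here \<open>dg\<close> stands for the subdegree of \<open>g\<close>; the two
    exponents are the indices in the product formula and add up to \<open>n\<close>.\<close>
  have "s powi n * (a * b) = s powi (i - dg) * a * (s powi (dg + n - i) * b)" for i dg a b
    using assms power_int_add[of s "i - dg" "dg + n - i"] by (simp add: mult_ac)
  then show "fls_nth (rot s (f * g)) n = fls_nth (rot s f * rot s g) n"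
    unfolding fls_nth_rot fls_times_nth(1)[of f] fls_times_nth(1)[of "rot s f"]
      fls_subdegree_rot[OF assms] sum_distrib_left by (intro sum.cong refl)
qed

lemma rot_const [simp]: "rot s (fls_const a) = fls_const a"
  by (intro fls_eqI) simp

lemma rot_hom: "s \<noteq> 0 \<Longrightarrow> comm_ring_hom (rot s)"
proof
  show "rot s 1 = 1" using rot_const[of s 1] by simp
qed (auto intro: fls_eqI simp: distrib_left rot_mult)

lemma rot_rot: "s \<noteq> 0 \<Longrightarrow> rot s (rot t f) = rot (s * t) f"
  by (intro fls_eqI) (simp add: power_int_mult_distrib mult.assoc)

lemma rot_1 [simp]: "rot 1 f = f"
  by (intro fls_eqI) simp

context
  fixes n :: nat and G :: "'k::field mat set" and bs :: "'k mat list"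
  assumes bs: "lie_basis n G bs"
begin

text \<open>The functionals dual to \<open>bs\<close> recover the coordinates over \<open>F\<close>
  as well. This makes \<open>F_coords\<close> a genuine inverse on \<open>gF n bs\<close>.\<close>

lemma inj_on_F_comb: "inj_on (F_comb n bs) (carrier_vec (length bs))"
proof (rule inj_onI)
  fix c d assume cd: "c \<in> carrier_vec (length bs)" "d \<in> carrier_vec (length bs)" "F_comb n bs c = F_comb n bs d"
  obtain w where w: "\<And>l m. l < length bs \<Longrightarrow> m < length bs \<Longrightarrow>
      (\<Sum>v\<in>{..<n} \<times> {..<n}. w l v * (bs ! m) $$ v) = (if l = m then 1 else 0)"
    using lin_comb_dual[of n bs] bs by (auto simp: lie_basis_def bij_betw_def)
  have "c $ l = d $ l" if "l < length bs" for l
  proof -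
    note dual = comm_ring_hom.dual_lin_comb[OF fls_const_hom w lie_basis_carrier[OF bs] that,
        folded F_comb_def]
    show ?thesis using dual[of c] dual[of d] cd(3) by simp
  qed
  then show "c = d"
    using cd(1,2) by (intro eq_vecI) auto
qed

lemma F_coords_F_comb: "c \<in> carrier_vec (length bs) \<Longrightarrow> F_coords n bs (F_comb n bs c) = c"
  unfolding F_coords_def by (rule the_inv_into_f_f[OF inj_on_F_comb])

lemma rot_F_comb:
  assumes "s \<noteq> 0" "c \<in> carrier_vec (length bs)"
  shows "map_mat (rot s) (F_comb n bs c) = F_comb n bs (map_vec (rot s) c)"
proof -
  interpret comm_ring_hom "rot s" by (rule rot_hom[OF assms(1)])
  show ?thesis
    using assms(2)
    by (intro eq_matI)
      (auto simp: F_comb_def lin_comb_index hom_sum hom_mult map_mat_nth_index[OF lie_basis_carrier[OF bs]])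
qed

text \<open>In coordinates the action is the semilinear map "rotate the coefficients, then apply
  \<open>a\<close>"; the laws of the action are derived from this form.\<close>

lemma Q_act_F_comb:
  assumes "s \<noteq> 0" "c \<in> carrier_vec (length bs)"
  shows "Q_act n bs (a, s) (F_comb n bs c) = F_comb n bs (a *\<^sub>v map_vec (rot s) c)"
  using assms by (simp add: Q_act_def rot_F_comb F_coords_F_comb)

text \<open>The twist in the semidirect product appears because \<open>rot s\<close> is a ring
  homomorphism: it carries \<open>b\<close> times a vector to the rotated matrix times the rotated
  vector.\<close>

lemma Q_act_mult:
  assumes "s \<noteq> 0" "t \<noteq> 0" "a \<in> carrier_mat (length bs) (length bs)"
    "b \<in> carrier_mat (length bs) (length bs)" "X \<in> gF n bs"
  shows "Q_act n bs (a * map_mat (rot s) b, s * t) X = Q_act n bs (a, s) (Q_act n bs (b, t) X)"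
proof -
  interpret comm_ring_hom "rot s" by (rule rot_hom[OF assms(1)])
  obtain c where c: "c \<in> carrier_vec (length bs)" "X = F_comb n bs c"
    using assms(5) by (auto simp: gF_def)
  have "map_vec (rot s) (map_vec (rot t) c) = map_vec (rot (s * t)) c"
    using assms(1) by (intro eq_vecI) (auto simp: rot_rot)
  then show ?thesis
    using assms(1-4) c
    by (simp add: Q_act_F_comb mult_mat_vec_hom[of _ "length bs" "length bs"]
        assoc_mult_mat_vec[of _ "length bs" "length bs" _ "length bs"])
qed

lemma Q_act_one: "X \<in> gF n bs \<Longrightarrow> Q_act n bs (1\<^sub>m (length bs), 1) X = X"
proof -
  assume "X \<in> gF n bs"
  then obtain c where c: "c \<in> carrier_vec (length bs)" "X = F_comb n bs c"
    by (auto simp: gF_def)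
  have "map_vec (rot 1) c = c" by (intro eq_vecI) auto
  then show ?thesis using c by (simp add: Q_act_F_comb)
qed

text \<open>Rotation fixes constants, so the semilinear action is linear over
  \<open>k\<close>.\<close>

lemma Q_act_smult:
  assumes "s \<noteq> 0" "a \<in> carrier_mat (length bs) (length bs)" "X \<in> gF n bs"
  shows "Q_act n bs (a, s) (fls_const k \<cdot>\<^sub>m X) = fls_const k \<cdot>\<^sub>m Q_act n bs (a, s) X"
proof -
  interpret comm_ring_hom "rot s" by (rule rot_hom[OF assms(1)])
  obtain c where c: "c \<in> carrier_vec (length bs)" "X = F_comb n bs c"
    using assms(3) by (auto simp: gF_def)
  have "Q_act n bs (a, s) (fls_const k \<cdot>\<^sub>m X) = Q_act n bs (a, s) (F_comb n bs (fls_const k \<cdot>\<^sub>v c))"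
    using c by (simp add: F_comb_def lin_comb_smult)
  also have "\<dots> = F_comb n bs (fls_const k \<cdot>\<^sub>v (a *\<^sub>v map_vec (rot s) c))"
    using assms c by (simp add: Q_act_F_comb vec_hom_smult mult_mat_vec[of _ "length bs" "length bs"])
  also have "\<dots> = fls_const k \<cdot>\<^sub>m Q_act n bs (a, s) X"
    using assms c by (simp add: Q_act_F_comb) (simp add: F_comb_def lin_comb_smult)
  finally show ?thesis .
qed

end

section \<open>The action of the multiplicative group through \<open>f\<close>\<close>

lemma Gm_group: "group (Gm :: 'k::field monoid)"
proof (rule groupI)
  fix x :: 'k assume "x \<in> carrier Gm"
  then show "\<exists>y\<in>carrier Gm. y \<otimes>\<^bsub>Gm\<^esub> x = \<one>\<^bsub>Gm\<^esub>"
    by (intro bexI[of _ "inverse x"]) (auto simp: Gm_def)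
qed (auto simp: Gm_def)

lemma Gm_simps [simp]:
  "carrier Gm = UNIV - {0::'k::field}" "x \<otimes>\<^bsub>Gm\<^esub> y = (x * y :: 'k)" "\<one>\<^bsub>Gm\<^esub> = (1::'k)"
  by (simp_all add: Gm_def)

context
  fixes n :: nat and G :: "'k::field mat set" and bs :: "'k mat list"
    and f :: "'k \<Rightarrow> 'k fls mat \<times> 'k"
  assumes bs: "lie_basis n G bs" and f: "Q_hom n G bs f"
begin

lemma Q_hom_carrier:
  assumes "t \<noteq> 0"
  shows "fst (f t) \<in> carrier (GL (length bs))" "fst (f t) \<in> carrier_mat (length bs) (length bs)"
    "snd (f t) \<noteq> 0"
proof -
  have "f t \<in> carrier (Q_group n G bs)"
    using f assms by (auto simp: Q_hom_def hom_def)
  then show "fst (f t) \<in> carrier (GL (length bs))" "snd (f t) \<noteq> 0"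
    by (auto simp: Q_group_def F_points_def)
  then show "fst (f t) \<in> carrier_mat (length bs) (length bs)"
    by (simp add: GL_carrier_mat)
qed

lemma Q_hom_mult:
  assumes "s \<noteq> 0" "t \<noteq> 0"
  shows "f (s * t) = (fst (f s) * map_mat (rot (snd (f s))) (fst (f t)), snd (f s) * snd (f t))"
  using f assms by (auto simp: Q_hom_def hom_def Q_group_def split_beta)

text \<open>\<open>f 1\<close> is idempotent. Its second component is a nonzero idempotent scalar,
  hence 1; the rotation is then trivial, and the first component is an idempotent in a
  group.\<close>

lemma Q_hom_one: "f 1 = (1\<^sub>m (length bs), 1)"
proof -
  define a where "a = fst (f 1)"
  have ff: "f 1 = (a * map_mat (rot (snd (f 1))) a, snd (f 1) * snd (f 1))"
    using Q_hom_mult[of 1 1] by (simp add: a_def)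
  then have s: "snd (f 1) = 1"
    using Q_hom_carrier(3)[of 1] by (metis mult_cancel_left2 snd_conv zero_neq_one)
  have "map_mat (rot 1) a = a" by (intro eq_matI) auto
  then have "a * a = a" using ff s by (simp add: a_def) (metis fst_conv)
  moreover have "a \<in> carrier (GL (length bs))" using Q_hom_carrier(1)[of 1] by (simp add: a_def)
  ultimately have "a = 1\<^sub>m (length bs)"
    using group.l_cancel_one[OF GL_group, of a "length bs" a] by simp
  then show ?thesis using s by (simp add: a_def prod_eq_iff)
qed

lemma Q_hom_act_mult:
  assumes "s \<noteq> 0" "t \<noteq> 0" "X \<in> gF n bs"
  shows "Q_act n bs (f (s * t)) X = Q_act n bs (f s) (Q_act n bs (f t) X)"
  using Q_act_mult[OF bs, of "snd (f s)" "snd (f t)" "fst (f s)" "fst (f t)" X] assms Q_hom_carrier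
  by (simp add: Q_hom_mult)

lemma Q_hom_act_smult:
  assumes "t \<noteq> 0" "X \<in> gF n bs"
  shows "Q_act n bs (f t) (fls_const k \<cdot>\<^sub>m X) = fls_const k \<cdot>\<^sub>m Q_act n bs (f t) X"
  using Q_act_smult[OF bs, of "snd (f t)" "fst (f t)" X] assms Q_hom_carrier by simp

lemma Q_hom_act_one: "X \<in> gF n bs \<Longrightarrow> Q_act n bs (f 1) X = X"
  by (simp add: Q_hom_one Q_act_one[OF bs])

lemma Q_hom_act_inverse:
  assumes "t \<noteq> 0" "X \<in> gF n bs"
  shows "Q_act n bs (f (inverse t)) (Q_act n bs (f t) X) = X"
  using Q_hom_act_mult[of "inverse t" t X] assms by (simp add: Q_hom_act_one)

lemma Q_hom_image_mult:
  assumes "s \<noteq> 0" "t \<noteq> 0" "\<pp> \<subseteq> gF n bs"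
  shows "Q_act n bs (f s) ` Q_act n bs (f t) ` \<pp> = Q_act n bs (f (s * t)) ` \<pp>"
  unfolding image_image using assms by (intro image_cong refl) (auto simp: Q_hom_act_mult)

lemma Q_hom_image_one:
  assumes "\<pp> \<subseteq> gF n bs"
  shows "Q_act n bs (f 1) ` \<pp> = \<pp>"
proof -
  have "Q_act n bs (f 1) ` \<pp> = (\<lambda>X. X) ` \<pp>"
    using assms by (intro image_cong refl) (auto simp: Q_hom_act_one)
  then show ?thesis by simp
qed

lemma mem_Q_act_image_iff:
  assumes N: "N \<in> gF n bs" "almost_commutes n bs f N" and t: "t \<noteq> 0"
    and sub: "\<pp> \<subseteq> gF n bs" and smult: "\<And>k X. X \<in> \<pp> \<Longrightarrow> fls_const k \<cdot>\<^sub>m X \<in> \<pp>"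
  shows "N \<in> Q_act n bs (f t) ` \<pp> \<longleftrightarrow> N \<in> \<pp>"
proof -
  obtain s :: int where s: "\<And>t. t \<noteq> 0 \<Longrightarrow> Q_act n bs (f t) N = fls_const (t powi s) \<cdot>\<^sub>m N"
    using N(2) by (auto simp: almost_commutes_def)
  show ?thesis
  proof
    assume "N \<in> Q_act n bs (f t) ` \<pp>"
    then obtain X where X: "X \<in> \<pp>" "N = Q_act n bs (f t) X" by blast
    then have "X = Q_act n bs (f (inverse t)) N"
      using sub t by (auto simp: Q_hom_act_inverse)
    then have X': "X = fls_const (inverse t powi s) \<cdot>\<^sub>m N"
      using s[of "inverse t"] t by simp
    have "N = fls_const (t powi s) \<cdot>\<^sub>m X"
      using t unfolding X'
      by (simp add: smult_smult_mat one_smult_mat flip: power_int_mult_distrib)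
    then show "N \<in> \<pp>" using smult X(1) by metis
  next
    assume "N \<in> \<pp>"
    \<comment> \<open>This multiple of \<open>N\<close> is the preimage of \<open>N\<close> under
      \<open>f t\<close>.\<close>
    then have "fls_const (inverse t powi s) \<cdot>\<^sub>m N \<in> \<pp>" by (rule smult)
    moreover have "Q_act n bs (f t) (fls_const (inverse t powi s) \<cdot>\<^sub>m N) = N"
      using t N by (simp add: Q_hom_act_smult s smult_smult_mat one_smult_mat flip: power_int_mult_distrib)
    ultimately show "N \<in> Q_act n bs (f t) ` \<pp>" by (metis imageI)
  qed
qed

text \<open>The maps are restricted to \<open>E\<close> because \<open>Bij E\<close> consists of
  extensional functions. Bijectivity comes from \<open>inverse t\<close>, whose action also
  preserves \<open>E\<close>.\<close>

lemma group_action_Q_hom: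
  assumes sub: "\<And>\<pp>. \<pp> \<in> E \<Longrightarrow> \<pp> \<subseteq> gF n bs" and pres: "preserves n bs f E"
  shows "group_action Gm E (\<lambda>t. \<lambda>\<pp> \<in> E. Q_act n bs (f t) ` \<pp>)"
proof -
  let ?\<phi> = "\<lambda>t. \<lambda>\<pp> \<in> E. Q_act n bs (f t) ` \<pp>"
  have closed: "Q_act n bs (f t) ` \<pp> \<in> E" if "t \<noteq> 0" "\<pp> \<in> E" for t \<pp>
    using that pres by (auto simp: preserves_def)
  have inv: "Q_act n bs (f s) ` Q_act n bs (f t) ` \<pp> = \<pp>" if "s * t = 1" "\<pp> \<in> E" for s t \<pp>
  proof -
    have "s \<noteq> 0" "t \<noteq> 0" using that(1) by auto
    then show ?thesis
      using that sub by (simp add: Q_hom_image_mult Q_hom_image_one)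
  qed
  have Bij: "?\<phi> t \<in> Bij E" if t: "t \<noteq> 0" for t
    unfolding Bij_def
  proof (intro IntI CollectI)
    show "bij_betw (?\<phi> t) E E"
      using t by (intro bij_betw_byWitness[where f' = "?\<phi> (inverse t)"]) (auto simp: closed inv)
  qed auto
  have "group_hom Gm (BijGroup E) ?\<phi>"
  proof (intro group_hom.intro group_hom_axioms.intro homI)
    fix s t :: 'k assume "s \<in> carrier Gm" "t \<in> carrier Gm"
    then have st: "s \<noteq> 0" "t \<noteq> 0" by auto
    have "?\<phi> (s * t) = compose E (?\<phi> s) (?\<phi> t)"
      using st sub by (intro ext) (simp add: compose_def closed Q_hom_image_mult)
    then show "?\<phi> (s \<otimes>\<^bsub>Gm\<^esub> t) = ?\<phi> s \<otimes>\<^bsub>BijGroup E\<^esub> ?\<phi> t"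
      using st Bij by (simp add: BijGroup_def)
  qed (use Bij in \<open>auto simp: BijGroup_def Gm_group group_BijGroup[unfolded BijGroup_def]\<close>)
  then show ?thesis by (rule group_action.intro)
qed

end

text \<open>Since \<open>f t\<close> could carry \<open>\<P>\<close> to a different conjugacy class,
  the first conjunct compares the members containing \<open>N\<close> in \<open>\<P>\<close> and in
  its translate. Once \<open>\<P>\<close> is preserved, the second conjunct gives the action on the
  subvariety.\<close>

theorem lemma2p1:
  fixes n :: nat and G :: "'k::alg_closed_field mat set" and bs :: "'k mat list"
    and \<P> :: "'k fls mat set set" and N :: "'k fls mat"
    and f :: "'k \<Rightarrow> 'k fls mat \<times> 'k"
  assumes "semisimple n G" and "simply_connected n G"
    and "lie_basis n G bs"
    and "affine_flag_manifold n G bs \<P>"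
    and "Q_hom n G bs f"
    and "N \<in> gF n bs" and "almost_commutes n bs f N"
  shows "(\<forall>t. t \<noteq> 0 \<longrightarrow>
            image (Q_act n bs (f t)) ` containing N \<P>
              = containing N (image (Q_act n bs (f t)) ` \<P>)) \<and>
         (preserves n bs f \<P> \<longrightarrow>
            preserves n bs f (containing N \<P>) \<and>
            group_action Gm (containing N \<P>)
              (\<lambda>t. \<lambda>\<pp> \<in> containing N \<P>. Q_act n bs (f t) ` \<pp>))"
proof -
  have G: "alg_group n G"
    using assms(1) by (simp add: semisimple_def connected_alg_group_def)
  obtain \<qq> where \<qq>: "lie_subalgebra n bs \<qq>" and \<P>: "\<P> = {Ad n g ` \<qq> | g. g \<in> F_points n G}"
    using assms(4) by (auto simp: affine_flag_manifold_def parahoric_def)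
  have sub: "\<pp> \<subseteq> gF n bs" if \<pp>: "\<pp> \<in> \<P>" for \<pp>
  proof -
    obtain g where g: "g \<in> F_points n G" "\<pp> = Ad n g ` \<qq>" using \<pp> by (auto simp: \<P>)
    have "\<qq> \<subseteq> gF n bs" using \<qq> by (simp add: lie_subalgebra_def)
    then show ?thesis using Ad_gF[OF G assms(3) g(1)] by (auto simp: g(2))
  qed
  \<comment> \<open>Closure under constants passes from \<open>\<qq>\<close> to its conjugates
    because \<open>Ad n g\<close> is linear.\<close>
  have smult: "fls_const k \<cdot>\<^sub>m X \<in> \<pp>" if \<pp>: "\<pp> \<in> \<P>" and X: "X \<in> \<pp>" for \<pp> k X
  proof -
    obtain g Y where g: "g \<in> F_points n G" "\<pp> = Ad n g ` \<qq>" and Y: "Y \<in> \<qq>" "X = Ad n g Y"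
      using \<pp> X by (auto simp: \<P>)
    have gGL: "g \<in> carrier (GL n)" using g(1) by (simp add: F_points_def)
    have "Y \<in> carrier_mat n n"
      using Y(1) \<qq> unfolding lie_subalgebra_def gF_def F_comb_def by fastforce
    then have "Ad n g (fls_const k \<cdot>\<^sub>m Y) = fls_const k \<cdot>\<^sub>m X"
      using GL_carrier_mat[OF gGL] GL_inv(1)[OF gGL]
      by (simp add: Ad_def Y(2) mult_smult_distrib[of _ n n _ n] mult_smult_assoc_mat[of _ n n _ n]
          mult_carrier_mat[of _ n n _ n] del: assoc_mult_mat)
    moreover have "fls_const k \<cdot>\<^sub>m Y \<in> \<qq>" using \<qq> Y(1) by (simp add: lie_subalgebra_def)
    ultimately show ?thesis using g(2) by (metis imageI)
  qed
  have mem: "N \<in> Q_act n bs (f t) ` \<pp> \<longleftrightarrow> N \<in> \<pp>" if "t \<noteq> 0" "\<pp> \<in> \<P>" for t \<pp>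
    using that by (intro mem_Q_act_image_iff[OF assms(3,5-7)] sub smult)
  show ?thesis
  proof (intro conjI allI impI)
    fix t :: 'k assume "t \<noteq> 0"
    \<comment> \<open>By \<open>mem\<close>, a member of \<open>\<P>\<close> contains
      \<open>N\<close> exactly when its translate does, so selecting the members containing
      \<open>N\<close> commutes with translation.\<close>
    then show "image (Q_act n bs (f t)) ` containing N \<P> = containing N (image (Q_act n bs (f t)) ` \<P>)"
      unfolding containing_def using mem by blast
  next
    assume "preserves n bs f \<P>"
    then show pres: "preserves n bs f (containing N \<P>)"
      by (simp add: preserves_def containing_def mem)
    show "group_action Gm (containing N \<P>) (\<lambda>t. \<lambda>\<pp> \<in> containing N \<P>. Q_act n bs (f t) ` \<pp>)"
      by (rule group_action_Q_hom[OF assms(3,5) _ pres]) (auto simp: containing_def dest: sub)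
  qed
qed

end
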